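(* Let $R$ be a commutative ring with unity and $I$ a proper ideal of $R$. There are the following isomorphisms of rings: 1) $\mathcal R_+/(I^2t^2)\cong R\ltimes I$; 2) $\mathcal R_+/(I^2(t^2-t))\cong R\Join I$.
   Context: The Rees algebra of $R$ with respect to $I$ is $\mathcal R_+=\bigoplus_{n\ge 0} I^nt^n\subseteq R[t]$. For a monic polynomial $f(t)\in R[t]$ of degree $k$, $(I^kf(t))$ denotes the ideal $f(t)R[t]\cap\mathcal R_+$ of $\mathcal R_+$. The idealization $R\ltimes I$ is the $R$-module $R\oplus I$ with multiplication $(r,i)(s,j)=(rs,rj+si)$. The (amalgamated) duplication is the subring $R\Join I=\{(r,r+i): r\in R,\ i\in I\}$ of $R\times R$. *)

theory Defs
  imports "HOL-Algebra.UnivPoly" "HOL-Algebra.Ideal_Product" "HOL-Algebra.Chinese_Remainder" "HOL-Algebra.Subrings"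
begin

definition indeterminate :: "('a, 'm) ring_scheme \<Rightarrow> nat \<Rightarrow> 'a"
  where "indeterminate R = monom (UP R) \<one>\<^bsub>R\<^esub> 1"

text \<open>\<^term>\<open>ideals_set R\<close> is the multiplicative monoid of ideals of \<^term>\<open>R\<close> with unit
  \<^term>\<open>carrier R\<close>, so the power below is the ideal power, and the zeroth power is the
  whole ring.\<close>

definition rees_algebra :: "('a, 'm) ring_scheme \<Rightarrow> 'a set \<Rightarrow> ('a, nat \<Rightarrow> 'a) up_ring"
  where "rees_algebra R I =
    (UP R)\<lparr>carrier := {p \<in> carrier (UP R).
                        \<forall>n. coeff (UP R) p n \<in> I [^]\<^bsub>ideals_set R\<^esub> n}\<rparr>"

text \<open>The ideal written $(I^k f(t))$ for \<^term>\<open>f\<close> monic of degree $k$; the degree is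
  determined by \<^term>\<open>f\<close> and hence is not a parameter.\<close>

definition rees_ideal :: "('a, 'm) ring_scheme \<Rightarrow> 'a set \<Rightarrow> (nat \<Rightarrow> 'a) \<Rightarrow> (nat \<Rightarrow> 'a) set"
  where "rees_ideal R I f = (PIdl\<^bsub>UP R\<^esub> f) \<inter> carrier (rees_algebra R I)"

definition idealization :: "('a, 'm) ring_scheme \<Rightarrow> 'a set \<Rightarrow> ('a \<times> 'a) ring"
  where "idealization R I =
    \<lparr>carrier = carrier R \<times> I,
     mult = (\<lambda>(r, i) (s, j). (r \<otimes>\<^bsub>R\<^esub> s, r \<otimes>\<^bsub>R\<^esub> j \<oplus>\<^bsub>R\<^esub> s \<otimes>\<^bsub>R\<^esub> i)),
     one = (\<one>\<^bsub>R\<^esub>, \<zero>\<^bsub>R\<^esub>),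
     zero = (\<zero>\<^bsub>R\<^esub>, \<zero>\<^bsub>R\<^esub>),
     add = (\<lambda>(r, i) (s, j). (r \<oplus>\<^bsub>R\<^esub> s, i \<oplus>\<^bsub>R\<^esub> j))\<rparr>"

definition duplication :: "('a, 'm) ring_scheme \<Rightarrow> 'a set \<Rightarrow> ('a \<times> 'a) ring"
  where "duplication R I =
    (RDirProd R R)\<lparr>carrier := {(r, r \<oplus>\<^bsub>R\<^esub> i) | r i. r \<in> carrier R \<and> i \<in> I}\<rparr>"

lemma ideal_power_ideal:
  assumes "cring R" "ideal I R"
  shows "ideal (I [^]\<^bsub>ideals_set R\<^esub> (n::nat)) R"
proof -
  interpret cring R by fact
  interpret M: comm_monoid "ideals_set R" by (rule ideals_set_is_comm_monoid)
  have "I [^]\<^bsub>ideals_set R\<^esub> n \<in> carrier (ideals_set R)"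
    by (rule M.nat_pow_closed) (simp add: ideals_set_def assms)
  then show ?thesis by (simp add: ideals_set_def)
qed

lemma ideal_finsum_closed:
  assumes "ideal J R" "finite A" "\<forall>i\<in>A. f i \<in> J"
  shows "finsum R f A \<in> J"
  using assms(2,3)
proof (induction A rule: finite_induct)
  interpret J: ideal J R by fact
  case empty
  then show ?case by simp
next
  interpret J: ideal J R by fact
  case (insert x F)
  have "f \<in> F \<rightarrow> carrier R" "f x \<in> carrier R"
    using insert.prems J.Icarr by blast+
  then show ?case
    using insert by (simp add: J.a_closed)
qed

lemma rees_algebra_subring:
  assumes "cring R" "ideal I R"
  shows "subring (carrier (rees_algebra R I)) (UP R)"
proof -
  interpret cring R by fact
  interpret M: comm_monoid "ideals_set R" by (rule ideals_set_is_comm_monoid)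
  interpret UP_cring R "UP R" by unfold_locales simp
  note pow = ideal_power_ideal[OF assms]
  note add_sub = ideal.axioms(1)[OF pow]
  have I: "I \<in> carrier (ideals_set R)" by (simp add: ideals_set_def assms)
  have mult: "a \<otimes>\<^bsub>R\<^esub> b \<in> I [^]\<^bsub>ideals_set R\<^esub> (m + n)"
    if "a \<in> I [^]\<^bsub>ideals_set R\<^esub> m" "b \<in> I [^]\<^bsub>ideals_set R\<^esub> n" for a b and m n :: nat
    using ideal_prod.prod[OF that, of R] M.nat_pow_mult[OF I, of m n]
    by (simp add: ideals_set_def)
  have sum: "finsum R f A \<in> I [^]\<^bsub>ideals_set R\<^esub> n"
    if "finite A" "\<forall>i\<in>A. f i \<in> I [^]\<^bsub>ideals_set R\<^esub> n" for f and n :: nat and A :: "nat set"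
    using ideal_finsum_closed[OF pow that] .
  have zero: "I [^]\<^bsub>ideals_set R\<^esub> (0::nat) = carrier R" by (simp add: ideals_set_def)
  show ?thesis
  proof (rule P.subringI)
    show "\<one>\<^bsub>UP R\<^esub> \<in> carrier (rees_algebra R I)"
      using zero by (auto simp: rees_algebra_def additive_subgroup.zero_closed[OF add_sub])
  next
    fix p assume "p \<in> carrier (rees_algebra R I)"
    then show "\<ominus>\<^bsub>UP R\<^esub> p \<in> carrier (rees_algebra R I)"
      by (auto simp: rees_algebra_def additive_subgroup.a_inv_closed[OF add_sub])
  next
    fix p q assume "p \<in> carrier (rees_algebra R I)" "q \<in> carrier (rees_algebra R I)"
    then show "p \<oplus>\<^bsub>UP R\<^esub> q \<in> carrier (rees_algebra R I)"
      by (auto simp: rees_algebra_def additive_subgroup.a_closed[OF add_sub])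
  next
    fix p q assume pq: "p \<in> carrier (rees_algebra R I)" "q \<in> carrier (rees_algebra R I)"
    have "coeff (UP R) p i \<otimes>\<^bsub>R\<^esub> coeff (UP R) q (n - i) \<in> I [^]\<^bsub>ideals_set R\<^esub> n"
      if "i \<le> n" for i n
      using mult[of "coeff (UP R) p i" i "coeff (UP R) q (n - i)" "n - i"] pq that
      by (auto simp: rees_algebra_def)
    then show "p \<otimes>\<^bsub>UP R\<^esub> q \<in> carrier (rees_algebra R I)"
      using pq by (auto simp: rees_algebra_def intro!: sum)
  qed (auto simp: rees_algebra_def)
qed

lemma rees_algebra_cring:
  assumes "cring R" "ideal I R"
  shows "cring (rees_algebra R I)"
proof -
  interpret UP_cring R "UP R" using assms(1) by (rule UP_cring.intro)
  have "rees_algebra R I = (UP R)\<lparr>carrier := carrier (rees_algebra R I)\<rparr>"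
    by (simp add: rees_algebra_def)
  then show ?thesis
    using P.subcring_iff[of "carrier (rees_algebra R I)"]
      P.subcringI'[OF rees_algebra_subring[OF assms]]
    by (metis subringE(1) rees_algebra_subring[OF assms])
qed

lemma rees_ideal_ideal:
  assumes "cring R" "ideal I R" "f \<in> carrier (UP R)"
  shows "ideal (rees_ideal R I f) (rees_algebra R I)"
proof -
  interpret UP_cring R "UP R" using assms(1) by (rule UP_cring.intro)
  interpret A: cring "rees_algebra R I" by (rule rees_algebra_cring[OF assms(1,2)])
  interpret J: ideal "PIdl\<^bsub>UP R\<^esub> f" "UP R" by (rule P.cgenideal_ideal[OF assms(3)])
  note Jadd = ideal.axioms(1)[OF P.cgenideal_ideal[OF assms(3)]]
  note sub = subringE[OF rees_algebra_subring[OF assms(1,2)]]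
  have eqs: "add (rees_algebra R I) = add (UP R)" "mult (rees_algebra R I) = mult (UP R)"
    "zero (rees_algebra R I) = zero (UP R)"
    by (simp_all add: rees_algebra_def)
  show ?thesis
  proof (rule idealI[OF A.ring_axioms])
    show "subgroup (rees_ideal R I f) (add_monoid (rees_algebra R I))"
    proof (rule A.add.subgroupI)
      show "rees_ideal R I f \<noteq> {}"
        unfolding rees_ideal_def using sub(2) additive_subgroup.zero_closed[OF Jadd] by blast
    next
      fix a assume a: "a \<in> rees_ideal R I f"
      then have "a \<in> carrier (UP R)" "\<ominus>\<^bsub>UP R\<^esub> a \<in> carrier (rees_algebra R I)"
        using sub(1,5) by (auto simp: rees_ideal_def)
      then have "\<ominus>\<^bsub>rees_algebra R I\<^esub> a = \<ominus>\<^bsub>UP R\<^esub> a"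
        by (intro A.minus_equality) (use a in \<open>auto simp: eqs rees_ideal_def P.l_neg\<close>)
      then show "\<ominus>\<^bsub>rees_algebra R I\<^esub> a \<in> rees_ideal R I f"
        using a sub(5) additive_subgroup.a_inv_closed[OF Jadd] by (auto simp: rees_ideal_def)
    qed (use sub additive_subgroup.a_closed[OF Jadd] in \<open>auto simp: rees_ideal_def eqs\<close>)
  qed (use sub(1,6) in \<open>auto simp: rees_ideal_def eqs intro: J.I_l_closed J.I_r_closed\<close>)
qed

lemma idealization_cring:
  assumes "cring R" "ideal I R"
  shows "cring (idealization R I)"
proof -
  interpret cring R by fact
  interpret ideal I R by fact
  have neg: "\<exists>y\<in>carrier R \<times> I. y \<oplus>\<^bsub>idealization R I\<^esub> x = \<zero>\<^bsub>idealization R I\<^esub>"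
    if "x \<in> carrier R \<times> I" for x
    using that by (intro bexI[of _ "(\<ominus>\<^bsub>R\<^esub> fst x, \<ominus>\<^bsub>R\<^esub> snd x)"])
      (auto simp: idealization_def l_neg Icarr)
  show ?thesis
  proof (intro cringI abelian_groupI comm_monoidI)
    fix x assume "x \<in> carrier (idealization R I)"
    then show "\<exists>y\<in>carrier (idealization R I). y \<oplus>\<^bsub>idealization R I\<^esub> x = \<zero>\<^bsub>idealization R I\<^esub>"
      using neg by (simp add: idealization_def)
  qed (auto simp: idealization_def intro!: I_l_closed, (auto simp: Icarr l_distr r_distr m_ac a_ac))
qed

lemma duplication_subring:
  assumes "cring R" "ideal I R"
  shows "subring (carrier (duplication R I)) (RDirProd R R)"
proof -
  interpret cring R by fact
  interpret ideal I R by fact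
  interpret D: ring "RDirProd R R" by (rule RDirProd_ring) unfold_locales
  have ops: "mult (RDirProd R R) = (\<lambda>(a, b) (c, d). (a \<otimes>\<^bsub>R\<^esub> c, b \<otimes>\<^bsub>R\<^esub> d))"
    "add (RDirProd R R) = (\<lambda>(a, b) (c, d). (a \<oplus>\<^bsub>R\<^esub> c, b \<oplus>\<^bsub>R\<^esub> d))"
    "one (RDirProd R R) = (\<one>\<^bsub>R\<^esub>, \<one>\<^bsub>R\<^esub>)" "zero (RDirProd R R) = (\<zero>\<^bsub>R\<^esub>, \<zero>\<^bsub>R\<^esub>)"
    by (simp_all add: RDirProd_def DirProd_def monoid.defs)
  have car: "carrier (duplication R I) =
      {(r, s). r \<in> carrier R \<and> s \<in> carrier R \<and> s \<ominus>\<^bsub>R\<^esub> r \<in> I}"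
  proof -
    have "s = r \<oplus>\<^bsub>R\<^esub> (s \<ominus>\<^bsub>R\<^esub> r)" if "r \<in> carrier R" "s \<in> carrier R" for r s
      using that by algebra
    moreover have "(r \<oplus>\<^bsub>R\<^esub> i) \<ominus>\<^bsub>R\<^esub> r = i" if "r \<in> carrier R" "i \<in> I" for r i
      using that Icarr[OF that(2)] by algebra
    ultimately show ?thesis by (auto simp: duplication_def Icarr)
  qed
  show ?thesis
  proof (rule D.subringI)
    show "carrier (duplication R I) \<subseteq> carrier (RDirProd R R)"
      by (auto simp: car RDirProd_carrier)
    show "\<one>\<^bsub>RDirProd R R\<^esub> \<in> carrier (duplication R I)"
      by (simp add: car ops a_minus_def r_neg)
  next
    fix x assume "x \<in> carrier (duplication R I)"
    then obtain r s where x: "x = (r, s)" "r \<in> carrier R" "s \<in> carrier R" "s \<ominus>\<^bsub>R\<^esub> r \<in> I"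
      by (auto simp: car)
    have "\<ominus>\<^bsub>RDirProd R R\<^esub> x = (\<ominus>\<^bsub>R\<^esub> r, \<ominus>\<^bsub>R\<^esub> s)"
      by (rule D.minus_equality) (use x in \<open>auto simp: ops RDirProd_carrier l_neg\<close>)
    moreover have "\<ominus>\<^bsub>R\<^esub> s \<ominus>\<^bsub>R\<^esub> \<ominus>\<^bsub>R\<^esub> r = \<ominus>\<^bsub>R\<^esub> (s \<ominus>\<^bsub>R\<^esub> r)" using x by algebra
    ultimately show "\<ominus>\<^bsub>RDirProd R R\<^esub> x \<in> carrier (duplication R I)"
      using x by (simp add: car)
  next
    fix x y assume "x \<in> carrier (duplication R I)" "y \<in> carrier (duplication R I)"
    then obtain r s r' s' where
      x: "x = (r, s)" "r \<in> carrier R" "s \<in> carrier R" "s \<ominus>\<^bsub>R\<^esub> r \<in> I" and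
      y: "y = (r', s')" "r' \<in> carrier R" "s' \<in> carrier R" "s' \<ominus>\<^bsub>R\<^esub> r' \<in> I"
      by (auto simp: car)
    have "(s \<oplus>\<^bsub>R\<^esub> s') \<ominus>\<^bsub>R\<^esub> (r \<oplus>\<^bsub>R\<^esub> r') = (s \<ominus>\<^bsub>R\<^esub> r) \<oplus>\<^bsub>R\<^esub> (s' \<ominus>\<^bsub>R\<^esub> r')"
      using x y by algebra
    then show "x \<oplus>\<^bsub>RDirProd R R\<^esub> y \<in> carrier (duplication R I)"
      using x y by (simp add: car ops)
    have "(s \<otimes>\<^bsub>R\<^esub> s') \<ominus>\<^bsub>R\<^esub> (r \<otimes>\<^bsub>R\<^esub> r') = (s \<ominus>\<^bsub>R\<^esub> r) \<otimes>\<^bsub>R\<^esub> s' \<oplus>\<^bsub>R\<^esub> r \<otimes>\<^bsub>R\<^esub> (s' \<ominus>\<^bsub>R\<^esub> r')"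
      using x y by algebra
    then show "x \<otimes>\<^bsub>RDirProd R R\<^esub> y \<in> carrier (duplication R I)"
      using x y by (simp add: car ops I_l_closed I_r_closed)
  qed
qed

end

theory Submission
  imports Defs
begin

text \<open>In both parts \<open>f\<close> is a monic quadratic, \<open>t\<^sup>2\<close> or \<open>t\<^sup>2 - t\<close>. Division by \<open>f\<close> writes every
  polynomial as a multiple of \<open>f\<close> plus a linear remainder \<open>a + b t\<close>. Hence, if a ring
  homomorphism \<open>h\<close> on \<open>R[t]\<close> kills \<open>f\<close> but no nonzero linear polynomial, its kernel on
  \<open>R[t]\<close> is exactly \<open>f R[t]\<close>. The kernel of its restriction to the Rees algebra is then \<open>f R[t]\<close>
  intersected with the Rees algebra, which is the ideal in the statement, and the first
  isomorphism theorem identifies the quotient with the image of the Rees algebra under \<open>h\<close>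
  (lemma \<open>rees_quotient_iso_image\<close>).

  It remains to choose \<open>h\<close> and to compute the image. For \<open>t\<^sup>2\<close>, \<open>h\<close> truncates: it sends \<open>p\<close> to its
  two lowest coefficients, a homomorphism to the dual numbers, that is, to the idealization
  of \<open>R\<close> by itself. For \<open>t\<^sup>2 - t = t (t - 1)\<close>, \<open>h\<close> evaluates at the two roots and lands in \<open>R \<times> R\<close>. The
  coefficient at \<open>t\<close> of an element of the Rees algebra lies in \<open>I\<close>, and so does \<open>p(1) - p(0)\<close>, the
  sum of all higher coefficients; conversely the polynomials \<open>r + i t\<close> with \<open>i \<in> I\<close> lie in the Rees
  algebra and already fill \<open>R \<ltimes> I\<close> and \<open>R \<Join> I\<close>, respectively.\<close>

section \<open>Quotients of the Rees algebra by a monic quadratic\<close>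

text \<open>Pseudo-division by \<open>f\<close> multiplies the dividend by a power of the leading coefficient of \<open>f\<close>,
  which is \<open>\<one>\<close> here.\<close>

lemma monic_quadratic_division:
  assumes "cring R" and f: "f \<in> carrier (UP R)" and deg: "deg R f = 2"
    and monic: "coeff (UP R) f 2 = \<one>\<^bsub>R\<^esub>" and p: "p \<in> carrier (UP R)"
  obtains q a b where "q \<in> carrier (UP R)" "a \<in> carrier R" "b \<in> carrier R"
    "p = f \<otimes>\<^bsub>UP R\<^esub> q \<oplus>\<^bsub>UP R\<^esub> (monom (UP R) a 0 \<oplus>\<^bsub>UP R\<^esub> monom (UP R) b 1)"
proof -
  interpret UP_cring R "UP R" using assms(1) by (rule UP_cring.intro)
  have "f \<noteq> \<zero>\<^bsub>UP R\<^esub>" using deg by auto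
  then obtain q r k where q: "q \<in> carrier (UP R)" and r: "r \<in> carrier (UP R)"
    and div: "coeff (UP R) f (deg R f) [^]\<^bsub>R\<^esub> (k::nat) \<odot>\<^bsub>UP R\<^esub> p = f \<otimes>\<^bsub>UP R\<^esub> q \<oplus>\<^bsub>UP R\<^esub> r"
    and less: "r = \<zero>\<^bsub>UP R\<^esub> \<or> deg R r < deg R f"
    using long_div_theorem[OF f p] by blast
  have "deg R r < 2" using less deg by auto
  then have high: "coeff (UP R) r n = \<zero>\<^bsub>R\<^esub>" if "n \<ge> 2" for n
    using that r by (intro deg_aboveD) auto
  let ?a = "coeff (UP R) r 0" and ?b = "coeff (UP R) r 1"
  have "r = monom (UP R) ?a 0 \<oplus>\<^bsub>UP R\<^esub> monom (UP R) ?b 1"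
  proof (rule up_eqI)
    fix n :: nat
    consider "n = 0" | "n = 1" | "n \<ge> 2" by linarith
    then show "coeff (UP R) r n = coeff (UP R) (monom (UP R) ?a 0 \<oplus>\<^bsub>UP R\<^esub> monom (UP R) ?b 1) n"
      using r by cases (auto simp: high)
  qed (use r in auto)
  then show ?thesis
    using that[of q ?a ?b] q r div p by (simp add: deg monic)
qed

text \<open>Since \<open>h\<close> kills \<open>f\<close>, it sees only the remainder of \<open>p\<close> modulo \<open>f\<close>, which is linear; so
  \<open>h p = \<zero>\<close> forces the remainder to vanish.\<close>

lemma kernel_eq_monic_quadratic_ideal:
  assumes "cring R" "ring S" and f: "f \<in> carrier (UP R)" "deg R f = 2" "coeff (UP R) f 2 = \<one>\<^bsub>R\<^esub>"
    and h: "h \<in> ring_hom (UP R) S" and hf: "h f = \<zero>\<^bsub>S\<^esub>"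
    and linear: "\<And>a b. \<lbrakk>a \<in> carrier R; b \<in> carrier R;
        h (monom (UP R) a 0 \<oplus>\<^bsub>UP R\<^esub> monom (UP R) b 1) = \<zero>\<^bsub>S\<^esub>\<rbrakk> \<Longrightarrow> a = \<zero>\<^bsub>R\<^esub> \<and> b = \<zero>\<^bsub>R\<^esub>"
  shows "a_kernel (UP R) S h = PIdl\<^bsub>UP R\<^esub> f"
proof -
  interpret UP_cring R "UP R" using assms(1) by (rule UP_cring.intro)
  interpret S: ring S by fact
  interpret h: ring_hom_ring "UP R" S h
    by (rule ring_hom_ringI2[OF P.ring_axioms S.ring_axioms h])
  show ?thesis
  proof (intro equalityI subsetI)
    fix p assume "p \<in> a_kernel (UP R) S h"
    then have p: "p \<in> carrier (UP R)" "h p = \<zero>\<^bsub>S\<^esub>" unfolding a_kernel_def' by simp_all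
    obtain q a b where q: "q \<in> carrier (UP R)" and ab: "a \<in> carrier R" "b \<in> carrier R"
      and eq: "p = f \<otimes>\<^bsub>UP R\<^esub> q \<oplus>\<^bsub>UP R\<^esub> (monom (UP R) a 0 \<oplus>\<^bsub>UP R\<^esub> monom (UP R) b 1)"
      using monic_quadratic_division[OF assms(1) f p(1)] .
    have "h p = h (monom (UP R) a 0 \<oplus>\<^bsub>UP R\<^esub> monom (UP R) b 1)"
      unfolding eq using f(1) q ab hf by simp
    then have "a = \<zero>\<^bsub>R\<^esub> \<and> b = \<zero>\<^bsub>R\<^esub>" using linear[OF ab] p(2) by metis
    then have "p = q \<otimes>\<^bsub>UP R\<^esub> f" using eq q f(1) by (simp add: P.m_comm)
    then show "p \<in> PIdl\<^bsub>UP R\<^esub> f" using q by (auto simp: cgenideal_def)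
  next
    fix p assume "p \<in> PIdl\<^bsub>UP R\<^esub> f"
    then obtain q where "q \<in> carrier (UP R)" "p = q \<otimes>\<^bsub>UP R\<^esub> f"
      unfolding cgenideal_def by blast
    then show "p \<in> a_kernel (UP R) S h"
      using f(1) hf unfolding a_kernel_def' by simp
  qed
qed

lemma rees_quotient_iso_image:
  assumes "cring R" "ideal I R" "ring S"
    and f: "f \<in> carrier (UP R)" "deg R f = 2" "coeff (UP R) f 2 = \<one>\<^bsub>R\<^esub>"
    and h: "h \<in> ring_hom (UP R) S" and hf: "h f = \<zero>\<^bsub>S\<^esub>"
    and linear: "\<And>a b. \<lbrakk>a \<in> carrier R; b \<in> carrier R;
        h (monom (UP R) a 0 \<oplus>\<^bsub>UP R\<^esub> monom (UP R) b 1) = \<zero>\<^bsub>S\<^esub>\<rbrakk> \<Longrightarrow> a = \<zero>\<^bsub>R\<^esub> \<and> b = \<zero>\<^bsub>R\<^esub>"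
  shows "rees_algebra R I Quot rees_ideal R I f
    \<simeq> S\<lparr>carrier := h ` carrier (rees_algebra R I)\<rparr>"
proof -
  interpret A: cring "rees_algebra R I" by (rule rees_algebra_cring[OF assms(1,2)])
  have sub: "carrier (rees_algebra R I) \<subseteq> carrier (UP R)"
    by (auto simp: rees_algebra_def)
  have "h \<in> ring_hom (rees_algebra R I) S"
    using h sub by (auto simp: ring_hom_def rees_algebra_def Pi_iff)
  then interpret h: ring_hom_ring "rees_algebra R I" S h
    by (rule ring_hom_ringI2[OF A.ring_axioms assms(3)])
  have "a_kernel (rees_algebra R I) S h = a_kernel (UP R) S h \<inter> carrier (rees_algebra R I)"
    unfolding a_kernel_def' using sub by blast
  also have "\<dots> = rees_ideal R I f"
    using kernel_eq_monic_quadratic_ideal[OF assms(1,3-)] by (simp add: rees_ideal_def)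
  finally show ?thesis
    using h.FactRing_iso_set_aux by (auto simp: is_ring_iso_def)
qed

section \<open>Coefficients of elements of the Rees algebra\<close>

lemma ideal_power_1:
  assumes "cring R" "ideal I R"
  shows "I [^]\<^bsub>ideals_set R\<^esub> (1::nat) = I"
proof -
  interpret cring R by fact
  interpret M: comm_monoid "ideals_set R" by (rule ideals_set_is_comm_monoid)
  show ?thesis using assms(2) by (intro M.nat_pow_eone) (simp add: ideals_set_def)
qed

lemma ideal_power_subset:
  assumes "cring R" "ideal I R" "n > 0"
  shows "I [^]\<^bsub>ideals_set R\<^esub> (n::nat) \<subseteq> I"
proof -
  interpret cring R by fact
  interpret M: comm_monoid "ideals_set R" by (rule ideals_set_is_comm_monoid)
  obtain m where n: "n = Suc m" using \<open>n > 0\<close> gr0_implies_Suc by blast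
  have "I [^]\<^bsub>ideals_set R\<^esub> n = ideal_prod R (I [^]\<^bsub>ideals_set R\<^esub> m) I"
    by (simp add: n ideals_set_def)
  then show ?thesis
    using ideal_prod_inter[OF ideal_power_ideal[OF assms(1,2), of m] assms(2)] by simp
qed

lemma rees_algebra_coeff:
  assumes "cring R" "ideal I R" "p \<in> carrier (rees_algebra R I)" "n > 0"
  shows "coeff (UP R) p n \<in> I"
  using ideal_power_subset[OF assms(1,2,4)] assms(3) by (auto simp: rees_algebra_def)

lemma linear_in_rees_algebra:
  assumes "cring R" "ideal I R" "r \<in> carrier R" "i \<in> I"
  shows "monom (UP R) r 0 \<oplus>\<^bsub>UP R\<^esub> monom (UP R) i 1 \<in> carrier (rees_algebra R I)"
proof -
  interpret UP_cring R "UP R" using assms(1) by (rule UP_cring.intro)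
  have i: "i \<in> carrier R" using assms(2,4) by (rule ideal.Icarr)
  have pow0: "I [^]\<^bsub>ideals_set R\<^esub> (0::nat) = carrier R" by (simp add: ideals_set_def)
  have zero: "\<zero>\<^bsub>R\<^esub> \<in> I [^]\<^bsub>ideals_set R\<^esub> n" for n :: nat
    using ideal_power_ideal[OF assms(1,2)] by (intro additive_subgroup.zero_closed ideal.axioms(1))
  have "coeff (UP R) (monom (UP R) r 0 \<oplus>\<^bsub>UP R\<^esub> monom (UP R) i 1) n \<in> I [^]\<^bsub>ideals_set R\<^esub> n" for n
  proof -
    consider "n = 0" | "n = 1" | "n \<ge> 2" by linarith
    then show ?thesis
      by cases (use assms(3,4) i zero[of n] pow0 ideal_power_1[OF assms(1,2)] in auto)
  qed
  then show ?thesis using assms(3) i by (simp add: rees_algebra_def)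
qed

text \<open>The value at \<open>\<one>\<close> is the sum of all coefficients; \<open>i\<close> collects those of positive index.\<close>

lemma eval_one_minus_const_coeff:
  assumes "cring R" "ideal I R" "p \<in> carrier (UP R)"
    and coeffs: "\<And>n. n > 0 \<Longrightarrow> coeff (UP R) p n \<in> I"
  shows "\<exists>i\<in>I. eval R R id \<one>\<^bsub>R\<^esub> p = coeff (UP R) p 0 \<oplus>\<^bsub>R\<^esub> i"
proof
  interpret UP_cring R "UP R" using assms(1) by (rule UP_cring.intro)
  let ?i = "finsum R (coeff (UP R) p) {0<..deg R p}"
  show "?i \<in> I" by (rule ideal_finsum_closed[OF assms(2)]) (auto simp: coeffs)
  have "eval R R id \<one>\<^bsub>R\<^esub> p = finsum R (coeff (UP R) p) {..deg R p}"
    using assms(3) by (simp add: eval_on_carrier cong: R.finsum_cong)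
  also have "{..deg R p} = insert 0 {0<..deg R p}" by auto
  also have "finsum R (coeff (UP R) p) \<dots> = coeff (UP R) p 0 \<oplus>\<^bsub>R\<^esub> ?i"
    using assms(3) by (subst R.finsum_insert) auto
  finally show "eval R R id \<one>\<^bsub>R\<^esub> p = coeff (UP R) p 0 \<oplus>\<^bsub>R\<^esub> ?i" .
qed

section \<open>The two homomorphisms\<close>

text \<open>With \<open>I = R\<close> the idealization is the ring of dual numbers \<open>R[t]/(t\<^sup>2)\<close>.\<close>

lemma truncation_ring_hom:
  assumes "cring R"
  shows "(\<lambda>p. (coeff (UP R) p 0, coeff (UP R) p 1))
    \<in> ring_hom (UP R) (idealization R (carrier R))"
proof -
  interpret UP_cring R "UP R" using assms(1) by (rule UP_cring.intro)
  have "{..Suc 0} = {0, Suc 0}" by auto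
  then show ?thesis
    by (intro ring_hom_memI) (auto simp: idealization_def R.m_comm R.a_comm)
qed

lemma evaluation_0_1_ring_hom:
  assumes "cring R"
  shows "(\<lambda>p. (coeff (UP R) p 0, eval R R id \<one>\<^bsub>R\<^esub> p)) \<in> ring_hom (UP R) (RDirProd R R)"
proof -
  interpret UP_pre_univ_prop R R id "UP R"
    using assms by (intro UP_pre_univ_propI id_ring_hom)
  have "eval R R id \<one>\<^bsub>R\<^esub> \<in> ring_hom (UP R) R" by (rule eval_ring_hom) simp
  then interpret e: ring_hom_ring "UP R" R "eval R R id \<one>\<^bsub>R\<^esub>"
    by (intro ring_hom_ringI2) (rule P.ring_axioms R.ring_axioms)+
  show ?thesis
    by (intro ring_hom_memI) (auto simp: RDirProd_def DirProd_def monoid.defs)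
qed

lemma rees_quotient_iso_idealization:
  assumes "cring R" "ideal I R" "\<one>\<^bsub>R\<^esub> \<noteq> \<zero>\<^bsub>R\<^esub>"
  shows "rees_algebra R I Quot rees_ideal R I (monom (UP R) \<one>\<^bsub>R\<^esub> 2) \<simeq> idealization R I"
proof -
  interpret UP_cring R "UP R" using assms(1) by (rule UP_cring.intro)
  let ?h = "\<lambda>p. (coeff (UP R) p 0, coeff (UP R) p 1)"
  let ?S = "idealization R (carrier R)"
  have "ring ?S"
    using idealization_cring[OF assms(1) R.oneideal] by (rule cring.axioms)
  then have iso: "rees_algebra R I Quot rees_ideal R I (monom (UP R) \<one>\<^bsub>R\<^esub> 2)
      \<simeq> ?S\<lparr>carrier := ?h ` carrier (rees_algebra R I)\<rparr>"
    by (rule rees_quotient_iso_image[OF assms(1,2) _ _ _ _ truncation_ring_hom[OF assms(1)]])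
      (use assms(3) in \<open>auto simp: idealization_def\<close>)
  have "?h ` carrier (rees_algebra R I) = carrier R \<times> I"
  proof (intro equalityI subsetI)
    fix x assume "x \<in> ?h ` carrier (rees_algebra R I)"
    then show "x \<in> carrier R \<times> I"
      using rees_algebra_coeff[OF assms(1,2), of _ 1] by (auto simp: rees_algebra_def)
  next
    fix x assume "x \<in> carrier R \<times> I"
    then obtain r i where x: "x = (r, i)" "r \<in> carrier R" "i \<in> I" "i \<in> carrier R"
      using ideal.Icarr[OF assms(2)] by auto
    then have "x = ?h (monom (UP R) r 0 \<oplus>\<^bsub>UP R\<^esub> monom (UP R) i 1)" by simp
    then show "x \<in> ?h ` carrier (rees_algebra R I)"
      using linear_in_rees_algebra[OF assms(1,2) x(2,3)] by blast
  qed
  then show ?thesis using iso by (simp add: idealization_def)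
qed

lemma rees_quotient_iso_duplication:
  assumes "cring R" "ideal I R" "\<one>\<^bsub>R\<^esub> \<noteq> \<zero>\<^bsub>R\<^esub>"
  shows "rees_algebra R I Quot
      rees_ideal R I (monom (UP R) \<one>\<^bsub>R\<^esub> 2 \<ominus>\<^bsub>UP R\<^esub> monom (UP R) \<one>\<^bsub>R\<^esub> 1) \<simeq> duplication R I"
proof -
  interpret UP_pre_univ_prop R R id "UP R"
    using assms(1) by (intro UP_pre_univ_propI id_ring_hom)
  let ?e = "eval R R id \<one>\<^bsub>R\<^esub>"
  let ?h = "\<lambda>p. (coeff (UP R) p 0, ?e p)"
  let ?f = "monom (UP R) \<one>\<^bsub>R\<^esub> 2 \<ominus>\<^bsub>UP R\<^esub> monom (UP R) \<one>\<^bsub>R\<^esub> 1"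
  have "?e \<in> ring_hom (UP R) R" by (rule eval_ring_hom) simp
  then interpret e: ring_hom_ring "UP R" R ?e
    by (intro ring_hom_ringI2) (rule P.ring_axioms R.ring_axioms)+
  have e_monom: "?e (monom (UP R) r n) = r" if "r \<in> carrier R" for r n
    using that by (simp add: eval_monom)
  have e_linear: "?e (monom (UP R) r 0 \<oplus>\<^bsub>UP R\<^esub> monom (UP R) i 1) = r \<oplus>\<^bsub>R\<^esub> i"
    if "r \<in> carrier R" "i \<in> carrier R" for r i
    using that by (simp add: e_monom)
  have f: "?f \<in> carrier (UP R)" by simp
  have f_coeff: "coeff (UP R) ?f n = (if n = 2 then \<one>\<^bsub>R\<^esub> else if n = 1 then \<ominus>\<^bsub>R\<^esub> \<one>\<^bsub>R\<^esub> else \<zero>\<^bsub>R\<^esub>)"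
    for n
    by (simp add: a_minus_def)
  have f_deg: "deg R ?f = 2"
  proof (rule antisym)
    show "deg R ?f \<le> 2" by (rule deg_aboveI[OF _ f]) (simp only: f_coeff, simp)
    show "2 \<le> deg R ?f" by (rule deg_belowI[OF _ f]) (simp only: f_coeff assms(3), simp add: assms(3))
  qed
  have "?e ?f = \<zero>\<^bsub>R\<^esub>"
    by (simp add: P.minus_eq e_monom R.r_neg)
  then have hf: "?h ?f = \<zero>\<^bsub>RDirProd R R\<^esub>"
    by (simp only: f_coeff) (simp add: RDirProd_def DirProd_def monoid.defs)
  have iso: "rees_algebra R I Quot rees_ideal R I ?f
      \<simeq> (RDirProd R R)\<lparr>carrier := ?h ` carrier (rees_algebra R I)\<rparr>"
  proof (rule rees_quotient_iso_image[where h = ?h, OF assms(1,2)])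
    show "ring (RDirProd R R)" by (intro RDirProd_ring R.ring_axioms)
    show "?f \<in> carrier (UP R)" by (rule f)
    show "deg R ?f = 2" by (rule f_deg)
    show "coeff (UP R) ?f 2 = \<one>\<^bsub>R\<^esub>" by (simp only: f_coeff) simp
    show "?h \<in> ring_hom (UP R) (RDirProd R R)" by (rule evaluation_0_1_ring_hom[OF assms(1)])
    show "?h ?f = \<zero>\<^bsub>RDirProd R R\<^esub>" by (rule hf)
  next
    fix a b assume ab: "a \<in> carrier R" "b \<in> carrier R"
      and h0: "?h (monom (UP R) a 0 \<oplus>\<^bsub>UP R\<^esub> monom (UP R) b 1) = \<zero>\<^bsub>RDirProd R R\<^esub>"
    have "?h (monom (UP R) a 0 \<oplus>\<^bsub>UP R\<^esub> monom (UP R) b 1) = (a, a \<oplus>\<^bsub>R\<^esub> b)"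
      unfolding e_linear[OF ab] using ab by simp
    then have "(a, a \<oplus>\<^bsub>R\<^esub> b) = \<zero>\<^bsub>RDirProd R R\<^esub>"
      by (rule subst) (rule h0)
    then have "a = \<zero>\<^bsub>R\<^esub>" "a \<oplus>\<^bsub>R\<^esub> b = \<zero>\<^bsub>R\<^esub>"
      by (auto simp: RDirProd_def DirProd_def monoid.defs)
    then show "a = \<zero>\<^bsub>R\<^esub> \<and> b = \<zero>\<^bsub>R\<^esub>" using ab(2) by simp
  qed
  have "?h ` carrier (rees_algebra R I) = {(r, r \<oplus>\<^bsub>R\<^esub> i) | r i. r \<in> carrier R \<and> i \<in> I}"
  proof (intro equalityI subsetI)
    fix x assume "x \<in> ?h ` carrier (rees_algebra R I)"
    then obtain p where x: "x = ?h p" and p: "p \<in> carrier (rees_algebra R I)" by blast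
    have pU: "p \<in> carrier (UP R)" using p by (simp add: rees_algebra_def)
    obtain i where "i \<in> I" "?e p = coeff (UP R) p 0 \<oplus>\<^bsub>R\<^esub> i"
      using eval_one_minus_const_coeff[OF assms(1,2) pU rees_algebra_coeff[OF assms(1,2) p]] by blast
    then show "x \<in> {(r, r \<oplus>\<^bsub>R\<^esub> i) | r i. r \<in> carrier R \<and> i \<in> I}"
      unfolding x using coeff_closed[OF pU] by blast
  next
    fix x assume "x \<in> {(r, r \<oplus>\<^bsub>R\<^esub> i) | r i. r \<in> carrier R \<and> i \<in> I}"
    then obtain r i where x: "x = (r, r \<oplus>\<^bsub>R\<^esub> i)" "r \<in> carrier R" "i \<in> I" "i \<in> carrier R"
      using ideal.Icarr[OF assms(2)] by auto
    then have "x = ?h (monom (UP R) r 0 \<oplus>\<^bsub>UP R\<^esub> monom (UP R) i 1)"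
      unfolding e_linear[OF x(2,4)] by simp
    then show "x \<in> ?h ` carrier (rees_algebra R I)"
      using linear_in_rees_algebra[OF assms(1,2) x(2,3)] by blast
  qed
  then show ?thesis using iso by (simp add: duplication_def)
qed

theorem proposition1p4:
  fixes R :: "('a, 'm) ring_scheme" and I :: "'a set"
  assumes "cring R" and "ideal I R" and "I \<noteq> carrier R"
  shows "rees_algebra R I Quot
           rees_ideal R I (indeterminate R [^]\<^bsub>UP R\<^esub> (2::nat))
         \<simeq> idealization R I
       \<and> rees_algebra R I Quot
           rees_ideal R I (indeterminate R [^]\<^bsub>UP R\<^esub> (2::nat) \<ominus>\<^bsub>UP R\<^esub> indeterminate R)
         \<simeq> duplication R I"
proof -
  interpret UP_cring R "UP R" using assms(1) by (rule UP_cring.intro)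
  interpret I: ideal I R by fact
  \<comment> \<open>In the zero ring \<open>t\<^sup>2\<close> would not have degree 2; properness of \<open>I\<close> excludes this case.\<close>
  have nontrivial: "\<one>\<^bsub>R\<^esub> \<noteq> \<zero>\<^bsub>R\<^esub>"
    using I.one_imp_carrier assms(3) I.zero_closed by metis
  have "indeterminate R [^]\<^bsub>UP R\<^esub> (2::nat) = monom (UP R) \<one>\<^bsub>R\<^esub> 2"
    by (simp add: indeterminate_def monom_pow)
  then show ?thesis
    using rees_quotient_iso_idealization[OF assms(1,2) nontrivial]
      rees_quotient_iso_duplication[OF assms(1,2) nontrivial]
    by (simp add: indeterminate_def)
qed

end
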